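(* Let $(\mathcal{P},\leq,\Omega)$ be a poset with a flow, and let $d_{\mathrm{GH}}$ be the generalized Gromov-Hausdorff distance between $\mathcal{P}$-indexed finite simplicial filtrations. Let $D$ be any (extended pseudo)metric on $\mathcal{P}$-indexed finite simplicial filtrations with the following properties: (i) for every finite nonempty set $X$, every filtration $\mathbf{F}_X:\mathcal{P}\to\mathbf{Simp}(X)$ and every surjection $\varphi_X:Z\twoheadrightarrow X$ from a finite set $Z$, $D(\mathbf{F}_X,\varphi_X^\ast\mathbf{F}_X)=0$; (ii) for every finite nonempty set $X$ and all filtrations $\mathbf{F}_X,\mathbf{G}_X:\mathcal{P}\to\mathbf{Simp}(X)$, $2\cdot D(\mathbf{F}_X,\mathbf{G}_X)\leq d_{\mathrm{I}}^{\mathbf{Simp}(X)}(\mathbf{F}_X,\mathbf{G}_X)$. Then $D\leq d_{\mathrm{GH}}$, i.e. $D(\mathbf{F}_X,\mathbf{G}_Y)\leq d_{\mathrm{GH}}(\mathbf{F}_X,\mathbf{G}_Y)$ for all filtrations $\mathbf{F}_X:\mathcal{P}\to\mathbf{Simp}(X)$ and $\mathbf{G}_Y:\mathcal{P}\to\mathbf{Simp}(Y)$ over finite nonempty sets $X,Y$.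
   Context: All vertex sets $X,Y,Z$ are nonempty and finite. "Metric" means extended pseudometric (values in $[0,\infty]$, symmetric, $D(x,x)=0$, triangle inequality). A (strict) flow on a poset $\mathcal{P}$ is a family $\Omega=\{\Omega_\varepsilon:\mathcal{P}\to\mathcal{P}\}_{\varepsilon\in[0,\infty)}$ of order-preserving maps such that $\Omega_s\leq\Omega_t$ pointwise for $s\leq t$, $\Omega_t\Omega_s=\Omega_{t+s}$, and $\Omega_0=\mathrm{id}_{\mathcal{P}}$. $\mathbf{Simp}(X)$ is the set of abstract simplicial complexes over a vertex set $A\subset X$ (including the empty complex), ordered by inclusion. A $\mathcal{P}$-indexed simplicial filtration over $X$ is an order-preserving map $\mathcal{P}\to\mathbf{Simp}(X)$. $d_{\mathrm{I}}^{\mathbf{Simp}(X)}(\mathbf{F},\mathbf{G})$ is the infimum of all $\varepsilon\in[0,\infty)$ such that $\mathbf{F}(p)\subset\mathbf{G}(\Omega_\varepsilon(p))$ and $\mathbf{G}(p)\subset\mathbf{F}(\Omega_\varepsilon(p))$ for all $p\in\mathcal{P}$ ($\infty$ if there is none). For a surjection $\varphi_X:Z\twoheadrightarrow X$ and a filtration $\mathbf{F}_X:\mathcal{P}\to\mathbf{Simp}(X)$, the pullback $\varphi_X^\ast\mathbf{F}_X:\mathcal{P}\to\mathbf{Simp}(Z)$ sends $p$ to the smallest simplicial complex in $\mathbf{Simp}(Z)$ containing all preimages $\varphi_X^{-1}(\tau)$, $\tau\in\mathbf{F}_X(p)$. A tripod between $X$ and $Y$ is a pair of surjections $R: X\twoheadleftarrow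 Z\twoheadrightarrow Y$, denoted $\varphi_X:Z\to X$ and $\varphi_Y:Z\to Y$. The generalized Gromov-Hausdorff distance is $d_{\mathrm{GH}}(\mathbf{F}_X,\mathbf{G}_Y):=\frac12\min_R d_{\mathrm{I}}^{\mathbf{Simp}(Z)}(\varphi_X^\ast\mathbf{F}_X,\varphi_Y^\ast\mathbf{G}_Y)$, the minimum being over all tripods between $X$ and $Y$. *)

theory Defs
  imports "HOL-Library.Extended_Nonnegative_Real" "HOL-Library.Infinite_Typeclass"
begin

text \<open>The poset is a type of class \<open>order\<close>; only the indices \<open>\<epsilon> \<ge> 0\<close> of a flow are meaningful.\<close>

definition flow :: "(real \<Rightarrow> 'p::order \<Rightarrow> 'p) \<Rightarrow> bool" where
  "flow \<Omega> \<longleftrightarrow>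
     (\<forall>\<epsilon>\<ge>0. mono (\<Omega> \<epsilon>)) \<and>
     (\<forall>s t p. 0 \<le> s \<and> s \<le> t \<longrightarrow> \<Omega> s p \<le> \<Omega> t p) \<and>
     (\<forall>s\<ge>0. \<forall>t\<ge>0. \<Omega> t \<circ> \<Omega> s = \<Omega> (t + s)) \<and>
     \<Omega> 0 = id"

text \<open>Simplices are nonempty, so the empty complex is the empty family, with vertex set \<open>{}\<close>.\<close>

definition simplicial_complex :: "'v set \<Rightarrow> 'v set set \<Rightarrow> bool" where
  "simplicial_complex A K \<longleftrightarrow>
     (\<forall>\<sigma>\<in>K. \<sigma> \<noteq> {} \<and> finite \<sigma> \<and> \<sigma> \<subseteq> A) \<and>
     (\<forall>a\<in>A. {a} \<in> K) \<and>
     (\<forall>\<sigma>\<in>K. \<forall>\<tau>. \<tau> \<noteq> {} \<and> \<tau> \<subseteq> \<sigma> \<longrightarrow> \<tau> \<in> K)"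

definition Simp :: "'v set \<Rightarrow> 'v set set set" where
  "Simp X = {K. \<exists>A\<subseteq>X. simplicial_complex A K}"

definition filtration :: "'v set \<Rightarrow> ('p::order \<Rightarrow> 'v set set) \<Rightarrow> bool" where
  "filtration X F \<longleftrightarrow> (\<forall>p. F p \<in> Simp X) \<and> mono F"

text \<open>A filtration carries its ambient vertex set \<open>X\<close>, which \<open>F\<close> alone does not determine.
  Vertex sets range over the finite nonempty subsets of one type \<open>'v\<close>. When \<open>'v\<close> is infinite,
  every finite set has a copy there, so no tripods are lost.\<close>

type_synonym ('p, 'v) filt = "'v set \<times> ('p \<Rightarrow> 'v set set)"

definition finite_filtrations :: "('p::order, 'v) filt set" where
  "finite_filtrations = {(X, F). finite X \<and> X \<noteq> {} \<and> filtration X F}"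

definition interleaved ::
    "(real \<Rightarrow> 'p::order \<Rightarrow> 'p) \<Rightarrow> real \<Rightarrow> ('p \<Rightarrow> 'v set set) \<Rightarrow> ('p \<Rightarrow> 'v set set) \<Rightarrow> bool" where
  "interleaved \<Omega> \<epsilon> F G \<longleftrightarrow> (\<forall>p. F p \<subseteq> G (\<Omega> \<epsilon> p) \<and> G p \<subseteq> F (\<Omega> \<epsilon> p))"

text \<open>In \<^typ>\<open>ennreal\<close> the infimum of the empty set is \<open>\<infinity>\<close>. The order on \<open>Simp X\<close> is inclusion,
  so the formula does not mention \<open>X\<close>.\<close>

definition interleaving_dist ::
    "(real \<Rightarrow> 'p::order \<Rightarrow> 'p) \<Rightarrow> ('p \<Rightarrow> 'v set set) \<Rightarrow> ('p \<Rightarrow> 'v set set) \<Rightarrow> ennreal" where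
  "interleaving_dist \<Omega> F G = Inf {ennreal \<epsilon> | \<epsilon>. 0 \<le> \<epsilon> \<and> interleaved \<Omega> \<epsilon> F G}"

definition pullback ::
    "'v set \<Rightarrow> ('v \<Rightarrow> 'v) \<Rightarrow> ('p \<Rightarrow> 'v set set) \<Rightarrow> 'p \<Rightarrow> 'v set set" where
  "pullback Z \<phi> F p = \<Inter>{K \<in> Simp Z. \<forall>\<tau>\<in>F p. \<phi> -` \<tau> \<inter> Z \<in> K}"

definition tripods :: "'v set \<Rightarrow> 'v set \<Rightarrow> ('v set \<times> ('v \<Rightarrow> 'v) \<times> ('v \<Rightarrow> 'v)) set" where
  "tripods X Y = {(Z, \<phi>, \<psi>). finite Z \<and> Z \<noteq> {} \<and> \<phi> ` Z = X \<and> \<psi> ` Z = Y}"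

text \<open>The infimum is a minimum: \<open>interleaving_dist\<close> is unchanged by a further pullback, so
  only the finitely many correspondences between \<open>X\<close> and \<open>Y\<close> contribute.\<close>

definition GH_dist ::
    "(real \<Rightarrow> 'p::order \<Rightarrow> 'p) \<Rightarrow> ('p, 'v::infinite) filt \<Rightarrow> ('p, 'v) filt \<Rightarrow> ennreal" where
  "GH_dist \<Omega> = (\<lambda>(X, F) (Y, G).
     (INF (Z, \<phi>, \<psi>) \<in> tripods X Y.
        interleaving_dist \<Omega> (pullback Z \<phi> F) (pullback Z \<psi> G)) / 2)"

definition ext_pseudometric_on :: "'a set \<Rightarrow> ('a \<Rightarrow> 'a \<Rightarrow> ennreal) \<Rightarrow> bool" where
  "ext_pseudometric_on S D \<longleftrightarrow>
     (\<forall>x\<in>S. D x x = 0) \<and>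
     (\<forall>x\<in>S. \<forall>y\<in>S. D x y = D y x) \<and>
     (\<forall>x\<in>S. \<forall>y\<in>S. \<forall>z\<in>S. D x z \<le> D x y + D y z)"

text \<open>The intersection defining \<open>pullback\<close> is itself a complex, the smallest one required.\<close>

lemma full_complex_in_Simp:
  assumes "finite Z"
  shows "Pow Z - {{}} \<in> Simp Z"
  unfolding Simp_def simplicial_complex_def using assms
  by (auto intro!: exI[of _ Z] intro: finite_subset)

lemma Inter_in_Simp:
  assumes "\<K> \<subseteq> Simp Z" "\<K> \<noteq> {}"
  shows "\<Inter>\<K> \<in> Simp Z"
proof -
  have K: "\<sigma> \<noteq> {} \<and> finite \<sigma> \<and> \<sigma> \<subseteq> Z \<and> (\<forall>\<tau>. \<tau> \<noteq> {} \<and> \<tau> \<subseteq> \<sigma> \<longrightarrow> \<tau> \<in> K)"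
    if "K \<in> \<K>" "\<sigma> \<in> K" for K \<sigma>
    using assms(1) that unfolding Simp_def simplicial_complex_def by blast
  have Int: "\<sigma> \<noteq> {} \<and> finite \<sigma> \<and> \<sigma> \<subseteq> Z" "\<tau> \<noteq> {} \<Longrightarrow> \<tau> \<subseteq> \<sigma> \<Longrightarrow> \<tau> \<in> \<Inter>\<K>"
    if "\<sigma> \<in> \<Inter>\<K>" for \<sigma> \<tau>
    using that K assms(2) by blast+
  have "simplicial_complex (\<Union>(\<Inter>\<K>)) (\<Inter>\<K>)"
    unfolding simplicial_complex_def
  proof (intro conjI ballI allI impI)
    fix a assume "a \<in> \<Union>(\<Inter>\<K>)"
    then obtain \<sigma> where "\<sigma> \<in> \<Inter>\<K>" "a \<in> \<sigma>" by blast
    then show "{a} \<in> \<Inter>\<K>" using Int(2)[of \<sigma> "{a}"] by blast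
  next
    fix \<sigma> assume "\<sigma> \<in> \<Inter>\<K>"
    then show "\<sigma> \<noteq> {}" "finite \<sigma>" "\<sigma> \<subseteq> \<Union>(\<Inter>\<K>)"
      using Int(1)[of \<sigma>] by blast+
  next
    fix \<sigma> \<tau> assume "\<sigma> \<in> \<Inter>\<K>" "\<tau> \<noteq> {} \<and> \<tau> \<subseteq> \<sigma>"
    then show "\<tau> \<in> \<Inter>\<K>" using Int(2)[of \<sigma> \<tau>] by blast
  qed
  moreover have "\<Union>(\<Inter>\<K>) \<subseteq> Z" using Int(1) by blast
  ultimately show ?thesis unfolding Simp_def by blast
qed

lemma pullback_in_Simp:
  assumes "filtration X F" "finite Z" "\<phi> ` Z = X"
  shows "pullback Z \<phi> F p \<in> Simp Z"
proof -
  have "\<phi> -` \<tau> \<inter> Z \<in> Pow Z - {{}}" if "\<tau> \<in> F p" for \<tau>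
  proof -
    have "\<tau> \<noteq> {}" "\<tau> \<subseteq> X"
      using assms(1) that unfolding filtration_def Simp_def simplicial_complex_def by blast+
    then show ?thesis using assms(3) by blast
  qed
  then have "Pow Z - {{}} \<in> {K \<in> Simp Z. \<forall>\<tau>\<in>F p. \<phi> -` \<tau> \<inter> Z \<in> K}"
    using full_complex_in_Simp[OF assms(2)] by blast
  then show ?thesis unfolding pullback_def by (intro Inter_in_Simp) blast+
qed

lemma preimage_in_pullback: "\<tau> \<in> F p \<Longrightarrow> \<phi> -` \<tau> \<inter> Z \<in> pullback Z \<phi> F p"
  unfolding pullback_def by blast

lemma pullback_least:
  "K \<in> Simp Z \<Longrightarrow> (\<And>\<tau>. \<tau> \<in> F p \<Longrightarrow> \<phi> -` \<tau> \<inter> Z \<in> K) \<Longrightarrow> pullback Z \<phi> F p \<subseteq> K"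
  unfolding pullback_def by blast

lemma filtration_pullback:
  fixes F :: "'p::order \<Rightarrow> 'v set set"
  assumes "filtration X F" "finite Z" "\<phi> ` Z = X"
  shows "filtration Z (pullback Z \<phi> F)"
proof -
  have "mono (pullback Z \<phi> F)"
  proof (rule monoI)
    fix p q :: 'p assume "p \<le> q"
    then have "F p \<subseteq> F q" using assms(1) unfolding filtration_def mono_def by blast
    then show "pullback Z \<phi> F p \<le> pullback Z \<phi> F q" unfolding pullback_def by blast
  qed
  then show ?thesis using pullback_in_Simp[OF assms] unfolding filtration_def by blast
qed

end

theory Submission
  imports Defs
begin

text \<open>A tripod \<open>X \<leftarrow> Z \<rightarrow> Y\<close> replaces filtrations over different vertex sets by their pullbacks to
  the common set \<open>Z\<close>. Property (i) says that this replacement costs \<open>D\<close> nothing, so by the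
  triangle inequality through the two pullbacks, \<open>D\<close> between the original filtrations is at most
  \<open>D\<close> between the pullbacks; property (ii) bounds the latter by half the interleaving distance
  over \<open>Z\<close>. This holds for every tripod, hence for the infimum that defines \<open>GH_dist\<close>.\<close>

text \<open>The triangle inequality along \<open>x, x', y', y\<close>, where the two outer steps have length zero.\<close>

lemma ext_pseudometric_le_of_dist_zero:
  assumes D: "ext_pseudometric_on S D"
    and S: "x \<in> S" "x' \<in> S" "y \<in> S" "y' \<in> S"
    and zero: "D x x' = 0" "D y y' = 0"
  shows "D x y \<le> D x' y'"
proof -
  have tri: "D a c \<le> D a b + D b c" if "a \<in> S" "b \<in> S" "c \<in> S" for a b c
    using D that unfolding ext_pseudometric_on_def by blast
  have sym: "D y' y = D y y'"
    using D S unfolding ext_pseudometric_on_def by blast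
  have "D x y \<le> D x x' + D x' y" by (intro tri S)
  also have "\<dots> = D x' y" using zero by simp
  also have "\<dots> \<le> D x' y' + D y' y" by (intro tri S)
  also have "\<dots> = D x' y'" using zero sym by simp
  finally show ?thesis .
qed

lemma pullback_in_finite_filtrations:
  assumes "(X, F) \<in> finite_filtrations" "finite Z" "\<phi> ` Z = X"
  shows "(Z, pullback Z \<phi> F) \<in> finite_filtrations"
  using assms filtration_pullback[of X F Z \<phi>] unfolding finite_filtrations_def by auto

lemma ennreal_le_half_iff:
  fixes a b :: ennreal
  shows "a \<le> b / 2 \<longleftrightarrow> 2 * a \<le> b"
proof
  assume "a \<le> b / 2"
  then have "2 * a \<le> 2 * (b / 2)" by (rule mult_left_mono) simp
  also have "\<dots> = b" by (simp add: ennreal_times_divide mult.commute[of 2] mult_divide_eq_ennreal)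
  finally show "2 * a \<le> b" .
next
  assume "2 * a \<le> b"
  then have "a * 2 / 2 \<le> b / 2" by (intro divide_right_mono_ennreal) (simp add: mult.commute)
  then show "a \<le> b / 2" by (simp add: mult_divide_eq_ennreal)
qed

theorem theorem4p11:
  fixes \<Omega> :: "real \<Rightarrow> 'p::order \<Rightarrow> 'p"
    and D :: "('p, 'v::infinite) filt \<Rightarrow> ('p, 'v) filt \<Rightarrow> ennreal"
  assumes "flow \<Omega>"
    and "ext_pseudometric_on finite_filtrations D"
    and "\<And>X F Z \<phi>. (X, F) \<in> finite_filtrations \<Longrightarrow> finite Z \<Longrightarrow> \<phi> ` Z = X \<Longrightarrow>
           D (X, F) (Z, pullback Z \<phi> F) = 0"
    and "\<And>X F G. (X, F) \<in> finite_filtrations \<Longrightarrow> (X, G) \<in> finite_filtrations \<Longrightarrow>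
           2 * D (X, F) (X, G) \<le> interleaving_dist \<Omega> F G"
  shows "\<forall>(X, F) \<in> finite_filtrations. \<forall>(Y, G) \<in> finite_filtrations.
           D (X, F) (Y, G) \<le> GH_dist \<Omega> (X, F) (Y, G)"
proof -
  note dist_pullback_zero = assms(3) and twice_dist_le_interleaving = assms(4)
  have "D (X, F) (Y, G) \<le> GH_dist \<Omega> (X, F) (Y, G)"
    if F: "(X, F) \<in> finite_filtrations" and G: "(Y, G) \<in> finite_filtrations" for X F Y G
  proof -
    have "2 * D (X, F) (Y, G) \<le> interleaving_dist \<Omega> (pullback Z \<phi> F) (pullback Z \<psi> G)"
      if "(Z, \<phi>, \<psi>) \<in> tripods X Y" for Z \<phi> \<psi>
    proof -
      have Z: "finite Z" "\<phi> ` Z = X" "\<psi> ` Z = Y"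
        using that unfolding tripods_def by auto
      let ?F = "(Z, pullback Z \<phi> F)" and ?G = "(Z, pullback Z \<psi> G)"
      have FG: "?F \<in> finite_filtrations" "?G \<in> finite_filtrations"
        using F G Z by (auto intro: pullback_in_finite_filtrations)
      have "D (X, F) (Y, G) \<le> D ?F ?G"
        using assms(2) F FG(1) G FG(2)
      proof (rule ext_pseudometric_le_of_dist_zero)
        show "D (X, F) ?F = 0" using F Z(1,2) by (rule dist_pullback_zero)
        show "D (Y, G) ?G = 0" using G Z(1,3) by (rule dist_pullback_zero)
      qed
      then have "2 * D (X, F) (Y, G) \<le> 2 * D ?F ?G" by (rule mult_left_mono) simp
      also have "\<dots> \<le> interleaving_dist \<Omega> (pullback Z \<phi> F) (pullback Z \<psi> G)"
        using FG by (rule twice_dist_le_interleaving)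
      finally show ?thesis .
    qed
    then show ?thesis
      unfolding GH_dist_def by (auto simp: ennreal_le_half_iff intro!: INF_greatest)
  qed
  then show ?thesis by blast
qed

end
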